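(* Let $p$ be the mesh pattern $(12,R)$ with $R=\{(0,0),(0,1),(0,2),(1,0),(2,0),(1,1)\}$. Then $$A_p(x)=(1-x)F(x)+x,\qquad F_p(x,q)=(1-x)F(x)+x+x\sum_{n=1}^{\infty}\prod_{i=0}^{n-1}(q+i)\,x^n .$$
   Context: $S_n$ is the set of permutations of $\{1,\dots,n\}$, $n\ge 0$ ($S_0$ consists of the empty permutation). A mesh pattern of length $k$ is a pair $(\tau,R)$ with $\tau\in S_k$ and $R\subseteq\{0,\dots,k\}\times\{0,\dots,k\}$ (the shaded boxes). Given $\pi=\pi_1\cdots\pi_n\in S_n$ and positions $i_1<\dots<i_k$, let $v_1<\dots<v_k$ be the values $\pi_{i_1},\dots,\pi_{i_k}$ sorted increasingly, and put $i_0=v_0=0$, $i_{k+1}=v_{k+1}=n+1$. The box $(r,s)$ contains the elements $\pi_j$ with $i_r<j<i_{r+1}$ and $v_s<\pi_j<v_{s+1}$. The subsequence $\pi_{i_1}\cdots\pi_{i_k}$ is an occurrence of $(\tau,R)$ if it is order-isomorphic to $\tau$ and every box in $R$ contains no element of $\pi$. For a mesh pattern $p$, $p(\pi)$ is the number of occurrences of $p$ in $\pi$, $F_p(x,q)=\sum_{n\ge0}x^n\sum_{\pi\in S_n}q^{p(\pi)}$, $A_p(x)=\sum_{n\ge 0}x^n\,|\{\pi\in S_n: p(\pi)=0\}|$, and $F(x)=\sum_{n\ge0}n!\,x^n$. All are formal power series. *)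

theory Defs
  imports
    "HOL-Combinatorics.Multiset_Permutations"
    "HOL-Computational_Algebra.Polynomial"
    "HOL-Computational_Algebra.Formal_Power_Series"
begin

text \<open>
  Permutations are written in one-line notation, as lists. Positions and values are counted
  from 1, whereas list indices start at 0.
\<close>

definition perms :: "nat \<Rightarrow> nat list set" where
  "perms n = permutations_of_set {1..n}"

definition entry :: "nat list \<Rightarrow> nat \<Rightarrow> nat" where
  "entry \<pi> j = \<pi> ! (j - 1)"

type_synonym mesh_pattern = "nat list \<times> (nat \<times> nat) set"

definition is_mesh_pattern :: "mesh_pattern \<Rightarrow> bool" where
  "is_mesh_pattern = (\<lambda>(\<tau>, R).
     \<tau> \<in> perms (length \<tau>) \<and> R \<subseteq> {0..length \<tau>} \<times> {0..length \<tau>})"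

text \<open>
  A choice of positions $i_1 < \dots < i_k$ is the strictly increasing list \<open>is\<close>. The bordered
  lists are $i_0, i_1, \dots, i_k, i_{k+1}$ and $v_0, v_1, \dots, v_k, v_{k+1}$ with
  $i_0 = v_0 = 0$ and $i_{k+1} = v_{k+1} = n + 1$, so here list index and subscript agree.
\<close>

definition bordered_positions :: "nat list \<Rightarrow> nat list \<Rightarrow> nat list" where
  "bordered_positions \<pi> is = 0 # is @ [length \<pi> + 1]"

definition bordered_values :: "nat list \<Rightarrow> nat list \<Rightarrow> nat list" where
  "bordered_values \<pi> is = 0 # sort (map (entry \<pi>) is) @ [length \<pi> + 1]"

definition box :: "nat list \<Rightarrow> nat list \<Rightarrow> nat \<Rightarrow> nat \<Rightarrow> nat set" where
  "box \<pi> is r s = {entry \<pi> j | j. j \<in> {1..length \<pi>} \<and>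
     bordered_positions \<pi> is ! r < j \<and> j < bordered_positions \<pi> is ! (r + 1) \<and>
     bordered_values \<pi> is ! s < entry \<pi> j \<and> entry \<pi> j < bordered_values \<pi> is ! (s + 1)}"

definition order_isomorphic :: "nat list \<Rightarrow> nat list \<Rightarrow> bool" where
  "order_isomorphic xs ys \<longleftrightarrow> length xs = length ys \<and>
     (\<forall>a < length xs. \<forall>b < length xs. xs ! a < xs ! b \<longleftrightarrow> ys ! a < ys ! b)"

text \<open>
  The entries of a permutation are distinct, so a subsequence is the same thing as the list of
  its positions; occurrences are identified with these lists.
\<close>

definition occurrences :: "mesh_pattern \<Rightarrow> nat list \<Rightarrow> nat list set" where
  "occurrences = (\<lambda>(\<tau>, R) \<pi>. {is. length is = length \<tau> \<and> sorted_wrt (<) is \<and>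
     set is \<subseteq> {1..length \<pi>} \<and> order_isomorphic (map (entry \<pi>) is) \<tau> \<and>
     (\<forall>(r, s) \<in> R. box \<pi> is r s = {})})"

definition num_occurrences :: "mesh_pattern \<Rightarrow> nat list \<Rightarrow> nat" where
  "num_occurrences p \<pi> = card (occurrences p \<pi>)"

text \<open>
  In bivariate series the outer power series variable \<open>fps_X\<close> is $x$, and $q$ is the
  indeterminate of the polynomial coefficients.
\<close>

definition q_var :: "int poly" where
  "q_var = [:0, 1:]"

definition distribution_gf :: "mesh_pattern \<Rightarrow> int poly fps" where
  "distribution_gf p = Abs_fps (\<lambda>n. \<Sum>\<pi> \<in> perms n. q_var ^ num_occurrences p \<pi>)"

definition avoidance_gf :: "mesh_pattern \<Rightarrow> int fps" where
  "avoidance_gf p = Abs_fps (\<lambda>n. int (card {\<pi> \<in> perms n. num_occurrences p \<pi> = 0}))"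

text \<open>Polymorphic, since it is used both over \<open>int\<close> and over \<open>int poly\<close>.\<close>

definition factorial_gf :: "'a :: comm_semiring_1 fps" where
  "factorial_gf = Abs_fps (\<lambda>n. of_nat (fact n))"

definition p_mesh :: mesh_pattern where
  "p_mesh = ([1, 2], {(0, 0), (0, 1), (0, 2), (1, 0), (2, 0), (1, 1)})"

lemma is_mesh_pattern_p_mesh: "is_mesh_pattern p_mesh"
  by (auto simp: is_mesh_pattern_def p_mesh_def perms_def permutations_of_set_def)

lemma finite_occurrences: "finite (occurrences p \<pi>)"
proof -
  obtain \<tau> R where p: "p = (\<tau>, R)" by (cases p)
  have "occurrences p \<pi> \<subseteq> {is. set is \<subseteq> {1..length \<pi>} \<and> length is = length \<tau>}"
    by (auto simp: occurrences_def p)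
  then show ?thesis
    by (rule finite_subset) (rule finite_lists_length_eq, simp)
qed

end

theory Submission
  imports Defs
begin

text \<open>
  The shaded boxes of \<open>p_mesh\<close> are its first column, its bottom row and the box \<open>(1, 1)\<close>. An
  element in the first column would stand before the smaller entry of the occurrence, and an element
  in the bottom row would lie below it; so the smaller entry must be the value 1 at position 1. The
  box \<open>(1, 1)\<close> then says that the larger entry is smaller than everything between it and
  position 1, that is, it is a left-to-right minimum of the rest of the permutation. Hence
  \<open>1 # xs\<close> has as many occurrences as \<open>xs\<close> has left-to-right minima, and a permutation that
  does not begin with 1 has none (\<open>occurrences_p_mesh\<close>).

  Left-to-right minima are distributed like cycles, with generating polynomial
  \<open>q (q + 1) \<dots> (q + m - 1)\<close> on \<open>m\<close> letters (\<open>sum_power_lr_minima\<close>). For length \<open>m + 1\<close> the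
  permutations beginning with 1 contribute this polynomial, and the others contribute the constant
  \<open>(m + 1)! - m!\<close>, which is the coefficient of \<open>(1 - x) F(x)\<close>; the extra term \<open>x\<close> corrects
  for the empty product at \<open>m = 0\<close>, which the sum over \<open>n \<ge> 1\<close> leaves out. Avoidance is the
  specialisation \<open>q = 0\<close>, which annihilates every product because of its factor \<open>i = 0\<close>.
\<close>

section \<open>Left-to-right minima\<close>

definition lr_minima :: "'a :: linorder list \<Rightarrow> nat set" where
  "lr_minima xs = {k. k < length xs \<and> (\<forall>i < k. xs ! k < xs ! i)}"

lemma finite_lr_minima: "finite (lr_minima xs)"
  by (simp add: lr_minima_def)

lemma lr_minima_Nil [simp]: "lr_minima [] = {}"
  by (simp add: lr_minima_def)

lemma lr_minima_snoc:
  "lr_minima (xs @ [a]) =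
     (if \<forall>x \<in> set xs. a < x then insert (length xs) (lr_minima xs) else lr_minima xs)"
  by (auto simp: lr_minima_def nth_append all_set_conv_all_nth less_Suc_eq)

lemma card_lr_minima_snoc:
  "card (lr_minima (xs @ [a])) = card (lr_minima xs) + (if \<forall>x \<in> set xs. a < x then 1 else 0)"
proof -
  have "length xs \<notin> lr_minima xs"
    by (simp add: lr_minima_def)
  then show ?thesis
    by (simp add: lr_minima_snoc finite_lr_minima)
qed

lemma permutations_of_set_snoc:
  assumes "A \<noteq> {}"
  shows "permutations_of_set A = (\<Union>a \<in> A. (\<lambda>xs. xs @ [a]) ` permutations_of_set (A - {a}))"
proof (intro equalityI subsetI)
  fix ys assume ys: "ys \<in> permutations_of_set A"
  with assms have "ys \<noteq> []"
    by (auto simp: permutations_of_set_def)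
  then obtain xs a where "ys = xs @ [a]"
    by (cases ys rule: rev_cases) auto
  with ys show "ys \<in> (\<Union>a \<in> A. (\<lambda>xs. xs @ [a]) ` permutations_of_set (A - {a}))"
    by (auto simp: permutations_of_set_def)
next
  fix ys assume "ys \<in> (\<Union>a \<in> A. (\<lambda>xs. xs @ [a]) ` permutations_of_set (A - {a}))"
  then obtain a xs where "a \<in> A" "ys = xs @ [a]" "set xs = A - {a}" "distinct xs"
    by (auto simp: permutations_of_set_def)
  then show "ys \<in> permutations_of_set A"
    by (simp add: permutations_of_set_def insert_absorb)
qed

text \<open>
  The last letter of an arrangement of \<open>A\<close> does not influence which earlier letters are
  left-to-right minima, and it is one itself exactly when it is the least element of \<open>A\<close>. So the
  choice of the last letter contributes the factor \<open>q + (card A - 1)\<close>.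
\<close>

lemma sum_power_lr_minima:
  fixes A :: "'a :: linorder set" and q :: "'b :: comm_semiring_1"
  assumes "finite A"
  shows "(\<Sum>xs \<in> permutations_of_set A. q ^ card (lr_minima xs)) = (\<Prod>i < card A. q + of_nat i)"
  using assms
proof (induction "card A" arbitrary: A)
  case 0
  then show ?case
    by simp
next
  case (Suc m)
  then have ne: "A \<noteq> {}"
    by auto
  let ?P = "\<Prod>i < m. q + of_nat i"
  have last: "(\<Sum>xs \<in> (\<lambda>xs. xs @ [a]) ` permutations_of_set (A - {a}). q ^ card (lr_minima xs)) =
      (if a = Min A then q else 1) * ?P" if a: "a \<in> A" for a
  proof -
    have "a = Min A \<longleftrightarrow> (\<forall>x \<in> A - {a}. a < x)"
      using a Suc.prems ne by (subst eq_commute) (auto simp: Min_eq_iff less_le)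
    moreover have "(\<Sum>xs \<in> permutations_of_set (A - {a}). q ^ card (lr_minima xs)) = ?P"
    proof -
      have "m = card (A - {a})"
        using Suc.hyps(2)[symmetric] Suc.prems a by simp
      with Suc.hyps(1)[of "A - {a}"] Suc.prems show ?thesis
        by simp
    qed
    moreover have "card (lr_minima (xs @ [a])) =
        card (lr_minima xs) + (if \<forall>x \<in> A - {a}. a < x then 1 else 0)"
      if "xs \<in> permutations_of_set (A - {a})" for xs
      using that by (simp add: card_lr_minima_snoc permutations_of_set_def)
    ultimately show ?thesis
      by (simp add: sum.reindex inj_on_def sum_distrib_left[symmetric])
  qed
  have "(\<Sum>xs \<in> permutations_of_set A. q ^ card (lr_minima xs)) =
      (\<Sum>a \<in> A. \<Sum>xs \<in> (\<lambda>xs. xs @ [a]) ` permutations_of_set (A - {a}). q ^ card (lr_minima xs))"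
    unfolding permutations_of_set_snoc[OF ne]
    by (rule sum.UNION_disjoint) (use Suc.prems in auto)
  also have "\<dots> = (\<Sum>a \<in> A. (if a = Min A then q else 1) * ?P)"
    using last by (rule sum.cong[OF refl])
  also have "\<dots> = (q + of_nat m) * ?P"
  proof -
    have "(\<Sum>a \<in> A. if a = Min A then q else 1) =
        q + (\<Sum>a \<in> A - {Min A}. if a = Min A then q else 1)"
      using Suc.prems ne by (subst sum.remove[of A "Min A"]) auto
    also have "(\<Sum>a \<in> A - {Min A}. if a = Min A then q else 1) = of_nat m"
    proof -
      have "card (A - {Min A}) = m"
        using Suc.prems Suc.hyps(2)[symmetric] ne by simp
      then show ?thesis
        by (subst sum.cong[OF refl, of _ _ "\<lambda>_. 1"]) auto
    qed
    finally show ?thesis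
      by (simp add: sum_distrib_right[symmetric])
  qed
  also have "\<dots> = (\<Prod>i < card A. q + of_nat i)"
    by (simp add: Suc.hyps(2)[symmetric] mult.commute)
  finally show ?case .
qed

section \<open>Occurrences of the pattern\<close>

lemma perms_entry:
  assumes "\<pi> \<in> perms n"
  shows "length \<pi> = n" and "bij_betw (entry \<pi>) {1..n} {1..n}"
proof -
  have d: "distinct \<pi>" "set \<pi> = {1..n}"
    using assms by (auto simp: perms_def permutations_of_set_def)
  show len: "length \<pi> = n"
    using distinct_card[OF d(1)] d(2) by simp
  have "bij_betw (\<lambda>j. j - 1) {1..n} {..<n}"
    by (rule bij_betw_byWitness[of _ Suc]) auto
  moreover have "bij_betw ((!) \<pi>) {..<n} {1..n}"
    using bij_betw_nth[OF d(1)] d(2) len by auto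
  ultimately have "bij_betw ((!) \<pi> \<circ> (\<lambda>j. j - 1)) {1..n} {1..n}"
    by (rule bij_betw_trans)
  moreover have "(!) \<pi> \<circ> (\<lambda>j. j - 1) = entry \<pi>"
    by (simp add: fun_eq_iff entry_def)
  ultimately show "bij_betw (entry \<pi>) {1..n} {1..n}"
    by simp
qed

lemma order_isomorphic_12:
  "order_isomorphic [a, b] [1, 2] \<longleftrightarrow> a < b"
  by (auto simp: order_isomorphic_def less_Suc_eq numeral_2_eq_2)

text \<open>
  The first column leaves no room for a position before the smaller entry, and the bottom row no
  room for a value below it, which pins that entry to value 1 at position 1. What remains of the
  pattern is the box \<open>(1, 1)\<close>.
\<close>

lemma occurrence_p_mesh_iff:
  assumes \<pi>: "\<pi> \<in> perms n"
  shows "is \<in> occurrences p_mesh \<pi> \<longleftrightarrow>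
    (\<exists>j. is = [1, j] \<and> 1 < j \<and> j \<le> n \<and> entry \<pi> 1 = 1 \<and>
      (\<forall>k. 1 < k \<and> k < j \<longrightarrow> entry \<pi> j < entry \<pi> k))"
    (is "?L \<longleftrightarrow> ?R")
proof -
  have range: "1 \<le> entry \<pi> k \<and> entry \<pi> k \<le> n" if "1 \<le> k" "k \<le> n" for k
    using bij_betwE[OF perms_entry(2)[OF \<pi>]] that by auto
  have inj: "k = l" if "entry \<pi> k = entry \<pi> l" "1 \<le> k" "k \<le> n" "1 \<le> l" "l \<le> n" for k l
    using bij_betw_imp_inj_on[OF perms_entry(2)[OF \<pi>]] that by (auto dest: inj_onD)
  note len = perms_entry(1)[OF \<pi>]
  show ?thesis
  proof
    assume ?L
    then have "length is = 2"
      by (simp add: occurrences_def p_mesh_def)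
    then obtain i j where is_eq: "is = [i, j]"
      by (auto simp: numeral_2_eq_2 length_Suc_conv)
    with \<open>?L\<close> have ij: "1 \<le> i" "i < j" "j \<le> n" and less: "entry \<pi> i < entry \<pi> j"
      by (auto simp: occurrences_def p_mesh_def len order_isomorphic_12 simp del: One_nat_def)
    have empty: "\<not> ([0, i, j, n + 1] ! r < k \<and> k < [0, i, j, n + 1] ! (r + 1) \<and>
        [0, entry \<pi> i, entry \<pi> j, n + 1] ! s < entry \<pi> k \<and>
        entry \<pi> k < [0, entry \<pi> i, entry \<pi> j, n + 1] ! (s + 1))"
      if "(r, s) \<in> snd p_mesh" "1 \<le> k" "k \<le> n" for r s k
    proof -
      have "box \<pi> is r s = {}"
        using \<open>?L\<close> that(1) by (auto simp: occurrences_def p_mesh_def)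
      moreover have "sort [entry \<pi> i, entry \<pi> j] = [entry \<pi> i, entry \<pi> j]"
        using less by simp
      ultimately show ?thesis
        using that(2,3)
        by (auto simp: box_def is_eq bordered_positions_def bordered_values_def len
            simp del: sort_key_simps)
    qed
    \<comment> \<open>Any element before position \<open>i\<close> lies in one of the three boxes of the first column.\<close>
    have column: "\<not> k < i" if "1 \<le> k" for k
    proof
      assume "k < i"
      with that ij have k: "1 \<le> k" "k \<le> n" "k \<noteq> i" "k \<noteq> j"
        by auto
      then have "entry \<pi> k \<noteq> entry \<pi> i" "entry \<pi> k \<noteq> entry \<pi> j"
        using inj ij by (metis le_trans less_imp_le)+
      then show False
        using empty[of 0 0 k] empty[of 0 1 k] empty[of 0 2 k] k range[of k] \<open>k < i\<close> less
        by (simp add: p_mesh_def; linarith)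
    qed
    have i: "i = 1"
      using column[of 1] ij by simp
    \<comment> \<open>Any element below \<open>entry \<pi> i\<close> lies in one of the three boxes of the bottom row.\<close>
    have row: "\<not> entry \<pi> k < entry \<pi> i" if k: "1 \<le> k" "k \<le> n" for k
    proof
      assume below: "entry \<pi> k < entry \<pi> i"
      with less have "k \<noteq> i" "k \<noteq> j"
        by auto
      then show False
        using empty[of 0 0 k] empty[of 1 0 k] empty[of 2 0 k] k range[of k] below
        by (simp add: p_mesh_def; linarith)
    qed
    have "1 \<in> entry \<pi> ` {1..n}"
      using bij_betw_imp_surj_on[OF perms_entry(2)[OF \<pi>]] ij by auto
    then have one: "entry \<pi> 1 = 1"
      using row range[of i] ij i by fastforce
    have "entry \<pi> j < entry \<pi> k" if k: "1 < k" "k < j" for k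
    proof (rule ccontr)
      assume "\<not> entry \<pi> j < entry \<pi> k"
      moreover have "entry \<pi> k \<noteq> entry \<pi> j"
        using inj[of k j] k ij by auto
      moreover have "entry \<pi> k \<noteq> entry \<pi> 1"
        using inj[of k 1] k ij by auto
      ultimately show False
        using empty[of 1 1 k] k ij range[of k] one i
        by (simp add: p_mesh_def)
    qed
    with is_eq i ij one show ?R
      by auto
  next
    assume ?R
    then obtain j where is_eq: "is = [1, j]" and j: "1 < j" "j \<le> n" and one: "entry \<pi> 1 = 1"
      and min: "\<And>k. 1 < k \<Longrightarrow> k < j \<Longrightarrow> entry \<pi> j < entry \<pi> k"
      by auto
    have less: "entry \<pi> 1 < entry \<pi> j"
      using range[of j] inj[of j 1] j one by fastforce
    have "box \<pi> is r s = {}" if "(r, s) \<in> snd p_mesh" for r s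
    proof -
      have "\<not> entry \<pi> k < entry \<pi> j" if "Suc 0 < k" "k < j" for k
        using min[of k] that by simp
      with that less one show ?thesis
        by (auto simp: p_mesh_def box_def is_eq bordered_positions_def bordered_values_def len)
    qed
    then show ?L
      using j less
      by (auto simp: occurrences_def p_mesh_def is_eq len order_isomorphic_12 simp del: One_nat_def)
  qed
qed

text \<open>
  Index \<open>k\<close> of \<open>xs\<close> is position \<open>k + 2\<close> of \<open>a # xs\<close>: one step for the letter \<open>a\<close>, one because
  positions count from 1.
\<close>

lemma occurrences_p_mesh:
  assumes "a # xs \<in> perms n"
  shows "occurrences p_mesh (a # xs) = (if a = 1 then (\<lambda>k. [1, k + 2]) ` lr_minima xs else {})"
proof -
  have len: "n = Suc (length xs)"
    using perms_entry(1)[OF assms] by simp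
  have shift: "(\<forall>k. 1 < k \<and> k < m + 2 \<longrightarrow> entry (a # xs) (m + 2) < entry (a # xs) k) \<longleftrightarrow>
      (\<forall>i < m. xs ! m < xs ! i)" for m
  proof safe
    fix i assume "\<forall>k. 1 < k \<and> k < m + 2 \<longrightarrow> entry (a # xs) (m + 2) < entry (a # xs) k" "i < m"
    from this(1)[rule_format, of "i + 2"] this(2) show "xs ! m < xs ! i"
      by (simp add: entry_def)
  next
    fix k assume "\<forall>i < m. xs ! m < xs ! i" "1 < k" "k < m + 2"
    from this(1)[rule_format, of "k - 2"] this(2,3)
    show "entry (a # xs) (m + 2) < entry (a # xs) k"
      by (auto simp: entry_def nth_Cons' numeral_2_eq_2)
  qed
  have "is \<in> occurrences p_mesh (a # xs) \<longleftrightarrow> (\<exists>m. is = [1, m + 2] \<and> a = 1 \<and> m \<in> lr_minima xs)"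
    for "is"
  proof -
    have "is \<in> occurrences p_mesh (a # xs) \<longleftrightarrow>
        (\<exists>m. is = [1, m + 2] \<and> m + 2 \<le> n \<and> a = 1 \<and>
          (\<forall>k. 1 < k \<and> k < m + 2 \<longrightarrow> entry (a # xs) (m + 2) < entry (a # xs) k))"
      unfolding occurrence_p_mesh_iff[OF assms]
    proof safe
      fix j assume j: "1 < j" "j \<le> n" "entry (a # xs) 1 = 1"
        "\<forall>k. 1 < k \<and> k < j \<longrightarrow> entry (a # xs) j < entry (a # xs) k"
      define m where "m = j - 2"
      with j(1) have "j = m + 2"
        by simp
      with j show "\<exists>m. [1, j] = [1, m + 2] \<and> m + 2 \<le> n \<and> a = 1 \<and>
          (\<forall>k. 1 < k \<and> k < m + 2 \<longrightarrow> entry (a # xs) (m + 2) < entry (a # xs) k)"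
        by (intro exI[of _ m]) (auto simp: entry_def)
    qed (auto simp: entry_def)
    also have "\<dots> \<longleftrightarrow> (\<exists>m. is = [1, m + 2] \<and> a = 1 \<and> m \<in> lr_minima xs)"
      unfolding shift by (auto simp: len lr_minima_def)
    finally show ?thesis .
  qed
  then show ?thesis
    by auto
qed

lemma num_occurrences_p_mesh:
  assumes "a # xs \<in> perms n"
  shows "num_occurrences p_mesh (a # xs) = (if a = 1 then card (lr_minima xs) else 0)"
  using occurrences_p_mesh[OF assms]
  by (simp add: num_occurrences_def card_image inj_on_def)

lemma num_occurrences_p_mesh_Nil: "num_occurrences p_mesh [] = 0"
proof -
  have "occurrences p_mesh [] = {}"
    by (auto simp: occurrences_def p_mesh_def)
  then show ?thesis
    by (simp add: num_occurrences_def)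
qed

section \<open>The generating functions\<close>

text \<open>
  The sum is split by the first letter. The letter 1 yields the polynomial of the left-to-right
  minima; each of the other \<open>m\<close> letters yields \<open>m!\<close>, one for every permutation beginning with it,
  and \<open>m * m! = (m + 1)! - m!\<close>.
\<close>

lemma sum_power_num_occurrences_p_mesh:
  fixes q :: "'a :: comm_ring_1"
  shows "(\<Sum>\<pi> \<in> perms (Suc m). q ^ num_occurrences p_mesh \<pi>) =
    of_nat (fact (Suc m)) - of_nat (fact m) + (\<Prod>i < m. q + of_nat i)"
proof -
  let ?S = "{1..Suc m}"
  let ?w = "\<lambda>\<pi>. q ^ num_occurrences p_mesh \<pi>"
  have perms: "perms (Suc m) = (\<Union>a \<in> ?S. (#) a ` permutations_of_set (?S - {a}))"
    unfolding perms_def by (rule permutations_of_set_nonempty) simp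
  have first: "(\<Sum>\<pi> \<in> (#) a ` permutations_of_set (?S - {a}). ?w \<pi>) =
      (if a = 1 then (\<Prod>i < m. q + of_nat i) else of_nat (fact m))" if a: "a \<in> ?S" for a
  proof -
    have card: "card (?S - {a}) = m"
      using a by simp
    have "num_occurrences p_mesh (a # xs) = (if a = 1 then card (lr_minima xs) else 0)"
      if "xs \<in> permutations_of_set (?S - {a})" for xs
    proof (rule num_occurrences_p_mesh)
      show "a # xs \<in> perms (Suc m)"
        unfolding perms using a that by blast
    qed
    then have "(\<Sum>\<pi> \<in> (#) a ` permutations_of_set (?S - {a}). ?w \<pi>) =
        (\<Sum>xs \<in> permutations_of_set (?S - {a}). q ^ (if a = 1 then card (lr_minima xs) else 0))"
      by (simp add: sum.reindex)
    also have "\<dots> = (if a = 1 then (\<Prod>i < m. q + of_nat i) else of_nat (fact m))"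
    proof (cases "a = 1")
      case True
      then show ?thesis
        using sum_power_lr_minima[of "?S - {a}" q] card by simp
    next
      case False
      then show ?thesis
        using card by simp
    qed
    finally show ?thesis .
  qed
  have "(\<Sum>\<pi> \<in> perms (Suc m). ?w \<pi>) =
      (\<Sum>a \<in> ?S. \<Sum>\<pi> \<in> (#) a ` permutations_of_set (?S - {a}). ?w \<pi>)"
    unfolding perms by (rule sum.UNION_disjoint) auto
  also have "\<dots> = (\<Sum>a \<in> ?S. if a = 1 then (\<Prod>i < m. q + of_nat i) else of_nat (fact m))"
    using first by (rule sum.cong[OF refl])
  also have "\<dots> = (\<Prod>i < m. q + of_nat i) +
      (\<Sum>a \<in> ?S - {1}. if a = 1 then (\<Prod>i < m. q + of_nat i) else of_nat (fact m))"
    by (subst sum.remove[of ?S 1]) auto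
  also have "(\<Sum>a \<in> ?S - {1}. if a = 1 then (\<Prod>i < m. q + of_nat i) else of_nat (fact m)) =
      (of_nat (m * fact m) :: 'a)"
    by (subst sum.cong[OF refl, of _ _ "\<lambda>_. of_nat (fact m)"]) auto
  finally show ?thesis
    by (simp add: algebra_simps)
qed

lemma fps_nth_distribution_gf_p_mesh:
  "fps_nth (distribution_gf p_mesh) 0 = 1"
  "fps_nth (distribution_gf p_mesh) (Suc m) =
    of_nat (fact (Suc m)) - of_nat (fact m) + (\<Prod>i < m. q_var + of_nat i)"
  by (simp_all only: distribution_gf_def fps_nth_Abs_fps sum_power_num_occurrences_p_mesh)
    (simp add: perms_def num_occurrences_p_mesh_Nil)

lemma fps_nth_one_minus_X_factorial_gf:
  "fps_nth ((1 - fps_X) * factorial_gf :: 'a :: comm_ring_1 fps) 0 = 1"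
  "fps_nth ((1 - fps_X) * factorial_gf :: 'a fps) (Suc m) =
    of_nat (fact (Suc m)) - of_nat (fact m)"
  by (simp_all only: left_diff_distrib fps_sub_nth mult_1_left factorial_gf_def fps_nth_Abs_fps)
    simp_all

text \<open>
  At \<open>q = 0\<close> the weight \<open>q ^ k\<close> is the indicator of \<open>k = 0\<close>, since \<open>0 ^ 0 = 1\<close>.
\<close>

lemma avoidance_gf_eq_distribution_gf_at_0:
  "fps_nth (avoidance_gf p) n = poly (fps_nth (distribution_gf p) n) 0"
proof -
  have "poly (fps_nth (distribution_gf p) n) 0 = (\<Sum>\<pi> \<in> perms n. 0 ^ num_occurrences p \<pi>)"
    by (simp add: distribution_gf_def poly_sum q_var_def)
  also have "\<dots> = (\<Sum>\<pi> \<in> perms n. if num_occurrences p \<pi> = 0 then 1 else 0)"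
    by (rule sum.cong) auto
  also have "\<dots> = fps_nth (avoidance_gf p) n"
    by (simp add: avoidance_gf_def perms_def sum.If_cases Int_def)
  finally show ?thesis ..
qed

theorem corollary2p5:
  "avoidance_gf p_mesh = (1 - fps_X) * factorial_gf + fps_X \<and>
   distribution_gf p_mesh = (1 - fps_X) * factorial_gf + fps_X +
     fps_X * Abs_fps (\<lambda>n. if n \<ge> 1 then (\<Prod>i = 0..n - 1. (q_var + of_nat i)) else 0)"
proof
  show "avoidance_gf p_mesh = (1 - fps_X) * factorial_gf + fps_X"
  proof (rule fps_ext)
    fix n show "fps_nth (avoidance_gf p_mesh) n = fps_nth ((1 - fps_X) * factorial_gf + fps_X) n"
    proof (cases n)
      case 0
      then show ?thesis
        by (simp only: avoidance_gf_eq_distribution_gf_at_0 fps_nth_distribution_gf_p_mesh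
            fps_add_nth fps_nth_one_minus_X_factorial_gf) simp
    next
      case (Suc m)
      \<comment> \<open>The case \<open>m = 0\<close>, an empty product, is the source of the summand \<open>fps_X\<close>.\<close>
      have "(\<Prod>i < m. int i) = (if m = 0 then 1 else 0)"
        by auto
      then have "poly (\<Prod>i < m. q_var + of_nat i) 0 = (if m = 0 then 1 else 0)"
        by (simp add: poly_prod q_var_def)
      with Suc show ?thesis
        by (simp only: avoidance_gf_eq_distribution_gf_at_0 fps_nth_distribution_gf_p_mesh
            fps_add_nth fps_nth_one_minus_X_factorial_gf poly_add poly_diff poly_of_nat) auto
    qed
  qed
  show "distribution_gf p_mesh = (1 - fps_X) * factorial_gf + fps_X +
     fps_X * Abs_fps (\<lambda>n. if n \<ge> 1 then (\<Prod>i = 0..n - 1. (q_var + of_nat i)) else 0)"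
    (is "_ = _ + _ + fps_X * ?G")
  proof (rule fps_ext)
    fix n
    show "fps_nth (distribution_gf p_mesh) n =
        fps_nth ((1 - fps_X) * factorial_gf + fps_X + fps_X * ?G) n"
    proof (cases n)
      case 0
      then show ?thesis
        by (simp only: fps_nth_distribution_gf_p_mesh fps_add_nth
            fps_nth_one_minus_X_factorial_gf) simp
    next
      case (Suc m)
      have "(\<Prod>i < m. q_var + of_nat i) =
          fps_nth fps_X (Suc m) + (if m \<ge> 1 then \<Prod>i = 0..m - 1. q_var + of_nat i else 0)"
      proof (cases m)
        case (Suc l)
        then show ?thesis
          by (simp add: lessThan_Suc_atMost atMost_atLeast0)
      qed simp
      with Suc show ?thesis
        by (simp only: fps_nth_distribution_gf_p_mesh fps_add_nth
            fps_nth_one_minus_X_factorial_gf) simp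
    qed
  qed
qed

end
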